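(* The scheme $\mathrm{Iab}_C\varphi\rightarrow[\overline{C}]\neg\varphi$ is not valid: there exist a finite non-empty set of agents $N$, a coalition $C\subseteq N$, a formula $\varphi$, a coalition model $\mathcal{M}$ over $N$ and a state $s$ with $\mathcal{M},s\models\mathrm{Iab}_C\varphi$ and $\mathcal{M},s\not\models[\overline{C}]\neg\varphi$.
   Context: A coalition is any $C\subseteq N$, $\overline{C}=N\setminus C$. Formulas: $\varphi ::= p \mid \neg\varphi \mid (\varphi\wedge\psi) \mid [C]\varphi \mid \mathrm{Iab}_C\varphi$ over a countable set $\mathrm{Prop}$ of variables. A coalition model is $\mathcal{M}=(S,\{Act_i\}_{i\in N},o,V)$ with $S$ non-empty, each $Act_i$ non-empty, $o:S\times\prod_{i\in N}Act_i\to S$, $V:\mathrm{Prop}\to 2^S$; $Act_C=\prod_{i\in C}Act_i$ ($Act_\emptyset$ contains only the empty profile). $\mathcal{M},s\models[C]\varphi$ iff there is $\sigma_C\in Act_C$ such that for all $\sigma_{\overline{C}}\in Act_{\overline{C}}$, $\mathcal{M},o(s,\sigma_C,\sigma_{\overline{C}})\models\varphi$; $\mathcal{M},s\models\mathrm{Iab}_C\varphi$ iff $\mathcal{M},s\not\models[C]\varphi$; atoms and Boolean connectives as usual. *)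

theory Defs
  imports "HOL-Library.FuncSet" "HOL-Library.Countable"
begin

datatype ('ag, 'p) fm =
    Atom 'p
  | Neg "('ag, 'p) fm"
  | Conj "('ag, 'p) fm" "('ag, 'p) fm"
  | Coal "'ag set" "('ag, 'p) fm"  \<comment> \<open>the coalition operator \<open>[C]\<phi>\<close>\<close>
  | Iab "'ag set" "('ag, 'p) fm"   \<comment> \<open>the inability operator \<open>Iab\<^sub>C \<phi>\<close>\<close>

text \<open>The datatype allows arbitrary sets of agents as coalitions; the formulas of the language over
  \<open>N\<close> are those in which every coalition is a subset of \<open>N\<close>.\<close>

primrec formula_over :: "'ag set \<Rightarrow> ('ag, 'p) fm \<Rightarrow> bool" where
  "formula_over N (Atom p) \<longleftrightarrow> True"
| "formula_over N (Neg \<phi>) \<longleftrightarrow> formula_over N \<phi>"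
| "formula_over N (Conj \<phi> \<psi>) \<longleftrightarrow> formula_over N \<phi> \<and> formula_over N \<psi>"
| "formula_over N (Coal C \<phi>) \<longleftrightarrow> C \<subseteq> N \<and> formula_over N \<phi>"
| "formula_over N (Iab C \<phi>) \<longleftrightarrow> C \<subseteq> N \<and> formula_over N \<phi>"

record ('ag, 'act, 's, 'p) cmodel =
  States :: "'s set"
  Act :: "'ag \<Rightarrow> 'act set"
  outcome :: "'s \<Rightarrow> ('ag \<Rightarrow> 'act) \<Rightarrow> 's"
  Val :: "'p \<Rightarrow> 's set"

text \<open>\<open>Act\<^sub>C\<close> is the extensional product, so \<open>Act\<^sub>\<emptyset>\<close> has exactly one element.\<close>

definition profiles :: "('ag, 'act, 's, 'p) cmodel \<Rightarrow> 'ag set \<Rightarrow> ('ag \<Rightarrow> 'act) set" where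
  "profiles M C = (\<Pi>\<^sub>E i\<in>C. Act M i)"

definition coalition_model :: "'ag set \<Rightarrow> ('ag, 'act, 's, 'p) cmodel \<Rightarrow> bool" where
  "coalition_model N M \<longleftrightarrow>
     States M \<noteq> {} \<and>
     (\<forall>i\<in>N. Act M i \<noteq> {}) \<and>
     (\<forall>s\<in>States M. \<forall>\<sigma>\<in>profiles M N. outcome M s \<sigma> \<in> States M) \<and>
     (\<forall>p. Val M p \<subseteq> States M)"

text \<open>For \<open>\<sigma> \<in> Act\<^sub>C\<close> and \<open>\<tau> \<in> Act\<^bsub>N - C\<^esub>\<close>, the combined profile \<open>(\<sigma>, \<tau>)\<close> is
  \<open>override_on \<tau> \<sigma> C\<close>: it agrees with \<open>\<sigma>\<close> on \<open>C\<close> and with \<open>\<tau>\<close> elsewhere.\<close>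

definition can_ensure ::
    "'ag set \<Rightarrow> ('ag, 'act, 's, 'p) cmodel \<Rightarrow> 'ag set \<Rightarrow> ('s \<Rightarrow> bool) \<Rightarrow> 's \<Rightarrow> bool" where
  "can_ensure N M C P s \<longleftrightarrow>
     (\<exists>\<sigma>\<in>profiles M C. \<forall>\<tau>\<in>profiles M (N - C). P (outcome M s (override_on \<tau> \<sigma> C)))"

primrec sat :: "'ag set \<Rightarrow> ('ag, 'act, 's, 'p) cmodel \<Rightarrow> ('ag, 'p) fm \<Rightarrow> 's \<Rightarrow> bool" where
  "sat N M (Atom p) s \<longleftrightarrow> s \<in> Val M p"
| "sat N M (Neg \<phi>) s \<longleftrightarrow> \<not> sat N M \<phi> s"
| "sat N M (Conj \<phi> \<psi>) s \<longleftrightarrow> sat N M \<phi> s \<and> sat N M \<psi> s"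
| "sat N M (Coal C \<phi>) s \<longleftrightarrow> can_ensure N M C (sat N M \<phi>) s"
| "sat N M (Iab C \<phi>) s \<longleftrightarrow> \<not> can_ensure N M C (sat N M \<phi>) s"

lemma sat_Iab_iff_not_Coal: "sat N M (Iab C \<phi>) s \<longleftrightarrow> \<not> sat N M (Coal C \<phi>) s"
  by simp

lemma override_on_profiles:
  assumes "C \<subseteq> N" "\<sigma> \<in> profiles M C" "\<tau> \<in> profiles M (N - C)"
  shows "override_on \<tau> \<sigma> C \<in> profiles M N"
  using assms by (auto simp: profiles_def override_on_def PiE_iff extensional_def)

end

theory Submission
  imports Defs
begin

text \<open>Inability of C says that every choice of C has a spoiling reply, which may depend on
  that choice; the scheme would need one reply that spoils all choices. Simultaneous moves block
  this exchange of quantifiers. Here every atom holds exactly at state 0, reached when the pennies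
  match: \<open>not_can_ensure_match\<close> gives the inability of {0},
  \<open>not_can_ensure_mismatch\<close> the failure of its complement {1} to force the
  negation.\<close>

text \<open>The counterexample is matching pennies: neither of the two players can force the pennies to
  match, and neither can force them to differ.\<close>

definition matching_pennies :: "(nat, nat, nat, 'p) cmodel" where
  "matching_pennies =
     \<lparr>States = {0, 1}, Act = (\<lambda>_. {0, 1}),
      outcome = (\<lambda>_ \<sigma>. if \<sigma> 0 = \<sigma> 1 then 0 else 1), Val = (\<lambda>_. {0})\<rparr>"

lemma coalition_model_matching_pennies: "coalition_model N matching_pennies"
  by (simp add: coalition_model_def matching_pennies_def)

lemma not_can_ensure_match:
  "\<not> can_ensure {0, 1} matching_pennies {0} (\<lambda>t. t \<in> Val matching_pennies p) s"
proof -
  have "\<exists>\<tau>\<in>profiles matching_pennies {1}.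
          outcome matching_pennies s (override_on \<tau> \<sigma> {0}) \<notin> Val matching_pennies p" for \<sigma>
    \<comment> \<open>Player 1 spoils a match by playing a legal action different from
      \<open>\<sigma> 0\<close>.\<close>
    by (rule bexI[of _ "\<lambda>i\<in>{1}. if \<sigma> 0 = 0 then 1 else 0"])
       (auto simp: matching_pennies_def profiles_def override_on_def)
  moreover have "{0, 1} - {0} = {1::nat}" by auto
  ultimately show ?thesis by (auto simp: can_ensure_def)
qed

lemma not_can_ensure_mismatch:
  "\<not> can_ensure {0, 1} matching_pennies {1} (\<lambda>t. t \<notin> Val matching_pennies p) s"
proof -
  have "\<exists>\<tau>\<in>profiles matching_pennies {0}.
          outcome matching_pennies s (override_on \<tau> \<sigma> {1}) \<in> Val matching_pennies p"
    if "\<sigma> \<in> profiles matching_pennies {1}" for \<sigma>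
    \<comment> \<open>Player 0 spoils a mismatch by copying; the copy is legal since both players
      have the same actions.\<close>
    by (rule bexI[of _ "\<lambda>i\<in>{0}. \<sigma> 1"])
       (use that in \<open>auto simp: matching_pennies_def profiles_def override_on_def PiE_iff\<close>)
  moreover have "{0, 1} - {1} = {0::nat}" by auto
  ultimately show ?thesis by (auto simp: can_ensure_def)
qed

theorem theorem4p25:
  shows "\<exists>(N :: nat set) (C :: nat set) (\<phi> :: (nat, 'p::countable) fm)
            (M :: (nat, nat, nat, 'p) cmodel) (s :: nat).
           finite N \<and> N \<noteq> {} \<and> C \<subseteq> N \<and> formula_over N \<phi> \<and>
           coalition_model N M \<and> s \<in> States M \<and>
           sat N M (Iab C \<phi>) s \<and> \<not> sat N M (Coal (N - C) (Neg \<phi>)) s"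
proof -
  fix p :: 'p
  \<comment> \<open>Equations between predicates, since \<open>can_ensure\<close> takes the truth
    set of the formula as an argument.\<close>
  have sat_Atom: "sat {0, 1} matching_pennies (Atom p) = (\<lambda>t. t \<in> Val matching_pennies p)"
    and sat_Neg: "sat {0, 1} matching_pennies (Neg (Atom p)) = (\<lambda>t. t \<notin> Val matching_pennies p)"
    by (simp_all add: fun_eq_iff)
  have compl: "{0, 1} - {0} = {1::nat}" by auto
  have "sat {0, 1} matching_pennies (Iab {0} (Atom p)) 0"
    unfolding sat.simps(5) sat_Atom by (rule not_can_ensure_match)
  moreover have "\<not> sat {0, 1} matching_pennies (Coal ({0, 1} - {0}) (Neg (Atom p))) 0"
    unfolding sat.simps(4) sat_Neg compl by (rule not_can_ensure_mismatch)
  moreover have "0 \<in> States matching_pennies" by (simp add: matching_pennies_def)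
  ultimately show ?thesis
    using coalition_model_matching_pennies
    by (intro exI[of _ "{0, 1}"] exI[of _ "{0}"] exI[of _ "Atom p"]
        exI[of _ matching_pennies] exI[of _ 0]) auto
qed

end
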